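(* Let $t_*>0$ and $(a_0,a_1)\in\mathbb R^2$ satisfy $\frac{a_0}{t_*}>a_1$. Then for any $n\in\mathbb N$ large enough there exist $0\le m_{t_*,a_0,a_1,n}<M_{t_*,a_0,a_1,n}<\infty$, depending on $t_*,a_0,a_1,n$, such that for any $a_2\in[m_{t_*,a_0,a_1,n},M_{t_*,a_0,a_1,n}]$ there exists a sequence of reals $\{c_{i,n}\}_{i=1}^n$ such that the locally constant potential $$\phi(x)=c_{x_0,n}\qquad\text{for } x=\cdots x_{-1}x_0x_1\cdots$$ on the full shift space $\Lambda_n^{\mathbb Z}$ satisfies $$P(t\phi)=a_0+a_1(t-t_* )+\frac{a_2}{2!}(t-t_* )^2+O\big((t-t_* )^3\big)$$ on $[t_*-\delta_n,t_*+\delta_n]$ for some $\delta_n>0$.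
   Context: $\Lambda_n=\{1,2,\dots,n\}$, and $\sigma$ is the shift on $\Lambda_n^{\mathbb Z}$. The pressure of a continuous potential is $P(\phi)=\lim_{m\to\infty}\frac1m\log\sum_{\sigma^m(x)=x}e^{\sum_{i=0}^{m-1}\phi(\sigma^ix)}$, equivalently $\sup\{h(\mu)+\int\phi\,d\mu:\mu\ \sigma\text{-invariant probability}\}$. *)

theory Defs
  imports Complex_Main
begin

definition full_shift :: "nat \<Rightarrow> (int \<Rightarrow> nat) set" where
  "full_shift n = {x. \<forall>i. x i \<in> {1..n}}"

definition shift :: "(int \<Rightarrow> nat) \<Rightarrow> (int \<Rightarrow> nat)" where
  "shift x = (\<lambda>i. x (i + 1))"

definition periodic_points :: "nat \<Rightarrow> nat \<Rightarrow> (int \<Rightarrow> nat) set" where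
  "periodic_points n m = {x \<in> full_shift n. (shift ^^ m) x = x}"

definition birkhoff_sum :: "((int \<Rightarrow> nat) \<Rightarrow> real) \<Rightarrow> nat \<Rightarrow> (int \<Rightarrow> nat) \<Rightarrow> real" where
  "birkhoff_sum \<phi> m x = (\<Sum>i<m. \<phi> ((shift ^^ i) x))"

text \<open>
  The limit exists for every continuous potential on the full shift over a nonempty alphabet;
  for other arguments the value of \<^const>\<open>lim\<close> is unspecified. The term at \<open>m = 0\<close> is
  immaterial for the limit.
\<close>

definition pressure :: "nat \<Rightarrow> ((int \<Rightarrow> nat) \<Rightarrow> real) \<Rightarrow> real" where
  "pressure n \<phi> =
     lim (\<lambda>m. 1 / real m * ln (\<Sum>x\<in>periodic_points n m. exp (birkhoff_sum \<phi> m x)))"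

end

theory Submission
  imports Defs "HOL-Analysis.Analysis" "HOL-Real_Asymp.Real_Asymp"
begin

text \<open>
  For a potential that depends on the zeroth symbol only, the pressure of \<open>t \<phi>\<close> equals
  \<open>f t = ln (\<Sum>i. exp (t * c i))\<close> (lemma \<open>pressure_locally_constant\<close>). So the task is to find real numbers
  \<open>c 1, \<dots>, c n\<close> such that \<open>f\<close> has value \<open>a0\<close>, slope \<open>a1\<close> and second derivative \<open>a2\<close> at \<open>t_star\<close>; since \<open>f\<close> is smooth, Taylor's
  theorem then bounds the error (lemma \<open>log_sum_exp_taylor\<close>).

  Once the value is \<open>a0\<close>, the numbers \<open>p i = exp (t_star * c i - a0)\<close> form a probability vector with
  positive entries, and conversely every such vector gives a potential \<open>c i = (ln (p i) + a0) / t_star\<close>. Under this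
  change of variables the slope is the mean of \<open>c\<close> under \<open>p\<close>, which is \<open>(a0 - H) / t_star\<close> for the entropy \<open>H\<close> of \<open>p\<close>,
  and the second derivative is the variance of \<open>ln p\<close> divided by \<open>t_star\<^sup>2\<close>. So the slope is \<open>a1\<close> exactly if \<open>p\<close> has
  entropy \<open>h = a0 - a1 * t_star\<close>. The hypothesis on \<open>a0\<close> and \<open>a1\<close> says that \<open>h\<close> is positive, and \<open>n\<close> is large enough
  when \<open>h < ln n\<close>, the maximal entropy on \<open>n\<close> symbols, and there are at least three symbols.

  It remains to show that the variance of \<open>ln p\<close> takes all values in some interval on the set of
  positive probability vectors of entropy \<open>h\<close>. A truncated geometric distribution provides a vector in
  this set with pairwise different entries (lemma \<open>geometric_distribution_of_entropy\<close>). At such a vector, the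
  map from three of the entries to total mass, entropy and second moment of \<open>ln p\<close> has an invertible
  derivative, essentially a Vandermonde matrix in the logarithms of the entries, so the map is open there
  (lemma \<open>moment_map_open_at\<close>) and the second moment can be moved while mass and entropy stay fixed
  (lemma \<open>second_moment_fills_interval\<close>).
\<close>

section \<open>Pressure of a potential depending on one symbol\<close>

lemma shift_funpow: "(shift ^^ m) x = (\<lambda>i. x (i + int m))"
  by (induction m) (auto simp: shift_def fun_eq_iff ac_simps)

text \<open>
  A point of period \<open>m\<close> is determined by its block of symbols at the positions \<open>0, \<dots>, m - 1\<close>,
  and this block is arbitrary. The blocks are taken as extensional functions so that a sum over
  them can be exchanged with a product.
\<close>

lemma bij_betw_periodic_points:
  assumes "m > 0"
  shows "bij_betw (\<lambda>w i. w (nat (i mod int m))) (PiE {..<m} (\<lambda>_. {1..n})) (periodic_points n m)"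
proof (rule bij_betwI[where g = "\<lambda>x. restrict (\<lambda>k. x (int k)) {..<m}"])
  have idx: "nat (i mod int m) < m" for i
    using assms by (simp add: nat_less_iff)
  show "(\<lambda>w i. w (nat (i mod int m))) \<in> PiE {..<m} (\<lambda>_. {1..n}) \<rightarrow> periodic_points n m"
    using idx by (auto simp: periodic_points_def full_shift_def shift_funpow PiE_iff)
  show "(\<lambda>x. restrict (\<lambda>k. x (int k)) {..<m}) \<in> periodic_points n m \<rightarrow> PiE {..<m} (\<lambda>_. {1..n})"
    by (auto simp: periodic_points_def full_shift_def)
  show "restrict (\<lambda>k. w (nat (int k mod int m))) {..<m} = w" if "w \<in> PiE {..<m} (\<lambda>_. {1..n})" for w
    using that by (auto simp: fun_eq_iff PiE_iff extensional_def)
  show "(\<lambda>i. restrict (\<lambda>k. x (int k)) {..<m} (nat (i mod int m))) = x"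
    if "x \<in> periodic_points n m" for x
  proof
    fix i
    have per: "x (j + int m) = x j" for j
      using that by (auto simp: periodic_points_def shift_funpow fun_eq_iff)
    have mult_pos: "x (j + int k * int m) = x j" for j k
    proof (induction k)
      case (Suc k)
      then show ?case using per[of "j + int k * int m"] by (simp add: algebra_simps)
    qed simp
    \<comment> \<open>The shift is iterated forwards only, so for negative \<open>i\<close> periodicity is applied from \<open>i\<close> upwards.\<close>
    have "x (i mod int m) = x i"
    proof (cases "i div int m \<ge> 0")
      case True
      then show ?thesis
        using mult_pos[of "i mod int m" "nat (i div int m)"] by (simp add: mod_div_mult_eq)
    next
      case False
      then have "i + int (nat (- (i div int m))) * int m = i mod int m"
        by (simp add: minus_div_mult_eq_mod)
      then show ?thesis
        using mult_pos[of i "nat (- (i div int m))"] by metis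
    qed
    then show "restrict (\<lambda>k. x (int k)) {..<m} (nat (i mod int m)) = x i"
      using idx assms by simp
  qed
qed

lemma partition_function_locally_constant:
  fixes c :: "nat \<Rightarrow> real"
  assumes "m > 0"
  shows "(\<Sum>x\<in>periodic_points n m. exp (birkhoff_sum (\<lambda>x. c (x 0)) m x)) = (\<Sum>j=1..n. exp (c j)) ^ m"
proof -
  have "(\<Sum>x\<in>periodic_points n m. exp (birkhoff_sum (\<lambda>x. c (x 0)) m x))
      = (\<Sum>w\<in>PiE {..<m} (\<lambda>_. {1..n}). \<Prod>i<m. exp (c (w i)))"
    unfolding sum.reindex_bij_betw[OF bij_betw_periodic_points[OF assms], symmetric]
    by (intro sum.cong refl) (simp add: birkhoff_sum_def shift_funpow exp_sum)
  also have "\<dots> = (\<Prod>i<m. \<Sum>j=1..n. exp (c j))"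
    by (rule prod_sum_PiE[symmetric]) auto
  finally show ?thesis by simp
qed

text \<open>
  The partition function over the points of period \<open>m\<close> is exactly an \<open>m\<close>-th power, so the sequence
  that defines the pressure is constant from \<open>m = 1\<close> on.
\<close>

lemma pressure_locally_constant:
  fixes c :: "nat \<Rightarrow> real"
  assumes "n > 0"
  shows "pressure n (\<lambda>x. c (x 0)) = ln (\<Sum>j=1..n. exp (c j))"
proof -
  have pos: "(\<Sum>j=1..n. exp (c j)) > 0"
    using assms by (intro sum_pos) auto
  have "eventually (\<lambda>m. 1 / real m * ln (\<Sum>x\<in>periodic_points n m. exp (birkhoff_sum (\<lambda>x. c (x 0)) m x))
      = ln (\<Sum>j=1..n. exp (c j))) sequentially"
    using eventually_gt_at_top[of 0]
    by eventually_elim (simp add: partition_function_locally_constant ln_realpow pos)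
  then show ?thesis
    unfolding pressure_def by (intro limI tendsto_eventually)
qed

section \<open>Expansion of the logarithm of an exponential sum\<close>

text \<open>
  The logarithm of the partition function is a cumulant generating function: its first two
  derivatives at \<open>s\<close> are the mean and the variance of \<open>c\<close> under the probability weights proportional to
  \<open>exp (s * c i)\<close>. The hypotheses prescribe total mass, mean and variance in unnormalised form. The third
  derivative is a rational function of the power sums \<open>Z k\<close> with denominators that are powers of the
  positive function \<open>Z 0\<close>, hence bounded near \<open>s\<close>, and this controls the Lagrange remainder.
\<close>

lemma log_sum_exp_taylor:
  fixes c :: "'i \<Rightarrow> real" and s :: real
  assumes "finite I" "I \<noteq> {}"
    and total: "(\<Sum>i\<in>I. exp (s * c i)) = exp a0"
    and mean: "(\<Sum>i\<in>I. c i * exp (s * c i)) = a1 * exp a0"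
    and square: "(\<Sum>i\<in>I. (c i)\<^sup>2 * exp (s * c i)) = (a2 + a1\<^sup>2) * exp a0"
  shows "\<exists>C. \<forall>t\<in>{s-1..s+1}.
    \<bar>ln (\<Sum>i\<in>I. exp (t * c i)) - (a0 + a1 * (t - s) + a2 / 2 * (t - s)\<^sup>2)\<bar>
      \<le> C * \<bar>t - s\<bar> ^ 3"
proof -
  define Z where "Z k t = (\<Sum>i\<in>I. c i ^ k * exp (t * c i))" for k t
  have dZ: "(Z k has_real_derivative Z (Suc k) t) (at t)" for k t
    unfolding Z_def by (auto intro!: derivative_eq_intros sum.cong)
  have Z_pos: "Z 0 t > 0" for t
    unfolding Z_def using assms by (intro sum_pos) auto
  \<comment> \<open>\<open>D k\<close> is the \<open>k\<close>-th cumulant of \<open>c\<close> for \<open>k \<le> 3\<close>, with arbitrary values for larger \<open>k\<close>.\<close>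
  define D where "D k t = (if k = 0 then ln (Z 0 t) else if k = 1 then Z 1 t / Z 0 t
      else if k = 2 then Z 2 t / Z 0 t - (Z 1 t / Z 0 t)\<^sup>2
      else Z 3 t / Z 0 t - 3 * (Z 1 t * Z 2 t) / (Z 0 t)\<^sup>2 + 2 * (Z 1 t / Z 0 t) ^ 3)"
    for k :: nat and t
  have D_deriv: "(D k has_real_derivative D (Suc k) t) (at t)" if "k < 3" for k t
  proof -
    have *: "(Z 0 has_real_derivative Z 1 t) (at t)" "(Z 1 has_real_derivative Z 2 t) (at t)"
      "(Z 2 has_real_derivative Z 3 t) (at t)"
      using dZ[of 0 t] dZ[of 1 t] dZ[of 2 t] by (simp_all add: eval_nat_numeral)
    have "Z 0 t \<noteq> 0" using Z_pos[of t] by simp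
    have "k = 0 \<or> k = 1 \<or> k = 2" using that by auto
    then consider "k = 0" | "k = 1" | "k = 2" by blast
    then show ?thesis
    proof cases
      case 1
      then show ?thesis using * Z_pos[of t] unfolding D_def
        by (auto intro!: derivative_eq_intros simp: field_simps)
    next
      case 2
      then show ?thesis using * \<open>Z 0 t \<noteq> 0\<close> unfolding D_def
        by (auto intro!: derivative_eq_intros simp: field_simps power2_eq_square)
    next
      case 3
      then show ?thesis using * \<open>Z 0 t \<noteq> 0\<close> unfolding D_def
        by (auto intro!: derivative_eq_intros simp: field_simps power2_eq_square power3_eq_cube)
    qed
  qed
  have cont: "continuous_on A (Z k)" for A k
    using dZ by (meson DERIV_continuous_on has_field_derivative_at_within)
  have "continuous_on {s-1..s+1} (D 3)"
    unfolding D_def using Z_pos by (auto intro!: continuous_intros cont simp: less_imp_neq[symmetric])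
  then have "bounded (D 3 ` {s-1..s+1})"
    by (intro compact_imp_bounded compact_continuous_image) auto
  then obtain B where B: "\<And>t. t \<in> {s-1..s+1} \<Longrightarrow> \<bar>D 3 t\<bar> \<le> B"
    unfolding bounded_iff by (metis image_eqI real_norm_def)
  have D_at: "D 0 s = a0" "D 1 s = a1" "D 2 s = a2"
    using total mean square by (simp_all add: D_def Z_def)
  show ?thesis
  proof (intro exI ballI)
    fix t assume t: "t \<in> {s-1..s+1}"
    show "\<bar>ln (\<Sum>i\<in>I. exp (t * c i)) - (a0 + a1 * (t - s) + a2 / 2 * (t - s)\<^sup>2)\<bar>
      \<le> B / 6 * \<bar>t - s\<bar> ^ 3"
    proof (cases "t = s")
      case True
      then show ?thesis by (simp add: total)
    next
      case False
      obtain r where r: "if t < s then t < r \<and> r < s else s < r \<and> r < t"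
        "D 0 t = (\<Sum>k<3. D k s / fact k * (t - s) ^ k) + D 3 r / fact 3 * (t - s) ^ 3"
        using Taylor[of 3 D "D 0" "s-1" "s+1" s t] D_deriv t False by auto
      have "(\<Sum>k<3. D k s / fact k * (t - s) ^ k)
          = a0 + a1 * (t - s) + a2 / 2 * (t - s)\<^sup>2"
        using D_at by (simp add: numeral_3_eq_3 numeral_2_eq_2)
      moreover have "D 0 t = ln (\<Sum>i\<in>I. exp (t * c i))"
        by (simp add: D_def Z_def)
      ultimately have "ln (\<Sum>i\<in>I. exp (t * c i)) - (a0 + a1 * (t - s) + a2 / 2 * (t - s)\<^sup>2)
          = D 3 r / 6 * (t - s) ^ 3"
        using r(2) by (simp add: fact_numeral)
      also have "\<bar>\<dots>\<bar> = \<bar>D 3 r\<bar> / 6 * \<bar>t - s\<bar> ^ 3"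
        by (simp add: abs_mult power_abs)
      also have "\<dots> \<le> B / 6 * \<bar>t - s\<bar> ^ 3"
        using B[of r] r(1) t by (intro mult_right_mono divide_right_mono) (auto split: if_splits)
      finally show ?thesis .
    qed
  qed
qed

section \<open>Probability vectors of prescribed entropy\<close>

text \<open>
  A truncated geometric distribution \<open>p i \<propto> exp (- \<beta> * (i - 1))\<close> has entropy \<open>ln n\<close> for \<open>\<beta> = 0\<close>, and its
  entropy tends to \<open>0\<close> as \<open>\<beta>\<close> tends to infinity because all mass concentrates on the first symbol.
  Every entropy strictly in between is attained for some \<open>\<beta> > 0\<close>, where the weights are pairwise
  different. The result is stated for the logarithms \<open>u i = ln (p i)\<close>. The geometric family is chosen
  over a simpler one because the variation of the second moment needs three different weights.
\<close>

lemma geometric_distribution_of_entropy: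
  fixes h :: real
  assumes "0 < h" "h < ln (real n)" "n > 0"
  shows "\<exists>u. inj_on u {1..n} \<and> (\<Sum>i=1..n. exp (u i)) = 1 \<and> (\<Sum>i=1..n. u i * exp (u i)) = -h"
proof -
  \<comment> \<open>The energies start at \<open>0\<close>, so that the partition function \<open>Z\<close> tends to \<open>1\<close>.\<close>
  define e where "e i = real (i - 1)" for i :: nat
  define Z where "Z \<beta> = (\<Sum>i=1..n. exp (- \<beta> * e i))" for \<beta>
  define S where "S \<beta> = (\<Sum>i=1..n. \<beta> * e i * exp (- \<beta> * e i))" for \<beta>
  define H where "H \<beta> = ln (Z \<beta>) + S \<beta> / Z \<beta>" for \<beta>
  have Z_pos: "Z \<beta> > 0" for \<beta>
    unfolding Z_def using assms(3) by (intro sum_pos) auto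
  have cont: "continuous_on A H" for A
  proof -
    have "continuous_on A Z" "continuous_on A S"
      unfolding Z_def S_def by (intro continuous_intros)+
    then show ?thesis
      unfolding H_def using Z_pos by (auto intro!: continuous_intros simp: less_imp_neq[symmetric])
  qed
  have H0: "H 0 = ln (real n)"
    by (simp add: H_def Z_def S_def)
  have "(Z \<longlongrightarrow> (\<Sum>i=1..n. if i = 1 then 1 else 0)) at_top"
    unfolding Z_def
  proof (intro tendsto_sum)
    fix i assume "i \<in> {1..n}"
    then consider "i = 1" | "e i > 0" "i \<noteq> 1" by (force simp: e_def)
    then show "((\<lambda>\<beta>. exp (- \<beta> * e i)) \<longlongrightarrow> (if i = 1 then 1 else 0)) at_top"
    proof cases
      case 2
      then show ?thesis by (simp, real_asymp)
    qed (simp add: e_def)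
  qed
  then have Z_lim: "(Z \<longlongrightarrow> 1) at_top" using assms(3) by simp
  have "(S \<longlongrightarrow> (\<Sum>i=1..n. 0)) at_top"
    unfolding S_def
  proof (intro tendsto_sum)
    fix i assume "i \<in> {1..n}"
    then consider "e i = 0" | "e i > 0" by (force simp: e_def)
    then show "((\<lambda>\<beta>. \<beta> * e i * exp (- \<beta> * e i)) \<longlongrightarrow> 0) at_top"
    proof cases
      case 2
      then show ?thesis by real_asymp
    qed simp
  qed
  then have S_lim: "(S \<longlongrightarrow> 0) at_top" by simp
  have "(H \<longlongrightarrow> ln 1 + 0 / 1) at_top"
    unfolding H_def by (intro tendsto_intros Z_lim S_lim) auto
  then have "eventually (\<lambda>\<beta>. H \<beta> < h) at_top"
    using order_tendstoD(2) assms(1) by fastforce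
  then have "eventually (\<lambda>\<beta>. H \<beta> < h \<and> \<beta> > 0) at_top"
    using eventually_gt_at_top[of 0] by eventually_elim auto
  then obtain b where b: "H b < h" "b > 0" 
    using eventually_happens'[OF trivial_limit_at_top_linorder] by blast
  obtain \<beta> where \<beta>: "0 \<le> \<beta>" "\<beta> \<le> b" "H \<beta> = h"
    using IVT2'[of H b h 0] b H0 assms(2) cont[of "{0..b}"] by (metis less_imp_le)
  have "\<beta> \<noteq> 0" using \<beta> H0 assms by auto
  define u where "u i = - \<beta> * e i - ln (Z \<beta>)" for i
  have exp_u: "exp (u i) = exp (- \<beta> * e i) / Z \<beta>" for i
    using Z_pos by (simp add: u_def exp_diff)
  have sum1: "(\<Sum>i=1..n. exp (u i)) = 1"
    using Z_pos[of \<beta>] unfolding exp_u by (simp add: sum_divide_distrib[symmetric] Z_def)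
  have "inj_on u {1..n}"
    using \<open>\<beta> \<noteq> 0\<close> by (auto simp: inj_on_def u_def e_def)
  moreover have "(\<Sum>i=1..n. u i * exp (u i)) = - h"
  proof -
    have "(\<Sum>i=1..n. u i * exp (u i))
        = (\<Sum>i=1..n. - (\<beta> * e i * exp (- \<beta> * e i)) / Z \<beta>) - ln (Z \<beta>) * (\<Sum>i=1..n. exp (u i))"
      unfolding sum_distrib_left sum_subtractf[symmetric]
      using Z_pos[of \<beta>] by (intro sum.cong refl) (simp add: exp_u, simp add: u_def field_simps)
    also have "\<dots> = - H \<beta>"
      unfolding sum1 by (simp add: H_def S_def sum_divide_distrib sum_negf)
    finally show ?thesis using \<beta> by simp
  qed
  ultimately show ?thesis using sum1 by blast
qed

section \<open>Variation of the second moment at fixed mass and entropy\<close>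

lemma vandermonde3_kernel:
  fixes x y z a b c :: real
  assumes "x \<noteq> y" "y \<noteq> z" "x \<noteq> z"
    and "a + b + c = 0" "a * x + b * y + c * z = 0" "a * x\<^sup>2 + b * y\<^sup>2 + c * z\<^sup>2 = 0"
  shows "a = 0 \<and> b = 0 \<and> c = 0"
proof -
  have *: "a = 0" if "x \<noteq> y" "x \<noteq> z"
    "a + b + c = 0" "a * x + b * y + c * z = 0" "a * x\<^sup>2 + b * y\<^sup>2 + c * z\<^sup>2 = 0"
    for x y z a b c :: real
  proof -
    \<comment> \<open>The polynomial \<open>(X - y) * (X - z)\<close> vanishes at two of the nodes and isolates the weight of the third.\<close>
    have "a * ((x - y) * (x - z)) = (a * x\<^sup>2 + b * y\<^sup>2 + c * z\<^sup>2)
        - (y + z) * (a * x + b * y + c * z) + y * z * (a + b + c)"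
      by (simp add: algebra_simps power2_eq_square)
    then show ?thesis using that by simp
  qed
  show ?thesis
    using assms *[of x y z a b c] *[of y x z b a c] *[of z x y c a b] by (auto simp: algebra_simps)
qed

text \<open>
  For fixed values of the other coordinates, \<open>moment_map\<close> describes how total mass, entropy (up to
  sign) and second moment of the log-weights depend on three of the log-weights.
\<close>

definition moment_map :: "real \<times> real \<times> real \<Rightarrow> real \<times> real \<times> real" where
  "moment_map = (\<lambda>(x, y, z). (exp x + exp y + exp z, x * exp x + y * exp y + z * exp z,
     x\<^sup>2 * exp x + y\<^sup>2 * exp y + z\<^sup>2 * exp z))"

text \<open>
  Row operations reduce the Jacobian of the moment map to a Vandermonde matrix with nodes
  \<open>x\<close>, \<open>y\<close>, \<open>z\<close> and columns scaled by exponentials: the derivatives of \<open>exp x\<close>, \<open>x * exp x\<close> and \<open>x\<^sup>2 * exp x\<close>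
  are \<open>exp x\<close> times \<open>1\<close>, \<open>1 + x\<close> and \<open>2 * x + x\<^sup>2\<close>, which span the polynomials of degree at most \<open>2\<close>. For
  three different nodes it is invertible, and the map is open at that point.
\<close>

lemma moment_map_open_at:
  fixes x y z :: real
  assumes "x \<noteq> y" "y \<noteq> z" "x \<noteq> z"
  shows "moment_map (x, y, z) \<in> interior (range moment_map)"
proof -
  define D :: "real \<times> real \<times> real \<Rightarrow> real \<times> real \<times> real" where
    "D = (\<lambda>(a, b, c). (a * exp x + b * exp y + c * exp z,
       a * ((1 + x) * exp x) + b * ((1 + y) * exp y) + c * ((1 + z) * exp z),
       a * ((2 * x + x\<^sup>2) * exp x) + b * ((2 * y + y\<^sup>2) * exp y) + c * ((2 * z + z\<^sup>2) * exp z)))"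
  have lin: "linear D"
    by (auto simp: linear_iff D_def algebra_simps)
  have deriv: "(moment_map has_derivative D) (at (x, y, z))"
    unfolding moment_map_def case_prod_unfold D_def
    by (auto intro!: derivative_eq_intros simp: fun_eq_iff algebra_simps)
  have "inj D"
    unfolding linear_injective_0[OF lin]
  proof safe
    fix a b c assume "D (a, b, c) = 0"
    then have e: "a * exp x + b * exp y + c * exp z = 0"
       "a * ((1 + x) * exp x) + b * ((1 + y) * exp y) + c * ((1 + z) * exp z) = 0"
       "a * ((2 * x + x\<^sup>2) * exp x) + b * ((2 * y + y\<^sup>2) * exp y) + c * ((2 * z + z\<^sup>2) * exp z) = 0"
      by (auto simp: D_def zero_prod_def)
    \<comment> \<open>In the weights \<open>p\<close>, \<open>q\<close>, \<open>r\<close> the three equations say that the moments of order \<open>0\<close>, \<open>1\<close>, \<open>2\<close> vanish.\<close>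
    define p q r where "p = a * exp x" "q = b * exp y" "r = c * exp z"
    have "p + q + r = 0" using e(1) by (simp add: p_q_r_def)
    moreover have "p * x + q * y + r * z = 0"
      using e(1,2) by (simp add: p_q_r_def algebra_simps)
    moreover have "p * x\<^sup>2 + q * y\<^sup>2 + r * z\<^sup>2 = 0"
      using e(3) calculation(2) by (simp add: p_q_r_def algebra_simps)
    ultimately have "p = 0 \<and> q = 0 \<and> r = 0"
      using assms by (intro vandermonde3_kernel[of x y z])
    then show "(a, b, c) = 0" by (simp add: p_q_r_def zero_prod_def)
  qed
  then obtain g where g: "linear g" "D \<circ> g = id"
    using linear_injective_imp_surjective[OF lin] linear_surjective_right_inverse[OF lin] by metis
  show ?thesis
  proof (rule sussmann_open_mapping[OF _ _ _ deriv _ g(2), of UNIV])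
    show "continuous_on UNIV moment_map"
      unfolding moment_map_def case_prod_unfold by (intro continuous_intros)
  qed (use g(1) in \<open>auto simp: linear_conv_bounded_linear\<close>)
qed

text \<open>
  Three of the log-weights suffice to move the second moment freely while mass and entropy stay
  fixed: by openness of the moment map, its value can be changed in the third coordinate alone by any
  small amount.
\<close>

lemma second_moment_fills_interval:
  fixes u :: "nat \<Rightarrow> real"
  assumes "finite I" "i \<in> I" "j \<in> I" "k \<in> I" "distinct [i, j, k]" "inj_on u I"
  shows "\<exists>\<epsilon>>0. \<forall>v. \<bar>v - (\<Sum>i\<in>I. (u i)\<^sup>2 * exp (u i))\<bar> < \<epsilon> \<longrightarrow>
    (\<exists>w. (\<Sum>i\<in>I. exp (w i)) = (\<Sum>i\<in>I. exp (u i)) \<and>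
         (\<Sum>i\<in>I. w i * exp (w i)) = (\<Sum>i\<in>I. u i * exp (u i)) \<and>
         (\<Sum>i\<in>I. (w i)\<^sup>2 * exp (w i)) = v)"
proof -
  have ne: "i \<noteq> j" "i \<noteq> k" "j \<noteq> k" using assms by auto
  have "u i \<noteq> u j" "u j \<noteq> u k" "u i \<noteq> u k"
    using assms ne by (auto simp: inj_on_eq_iff)
  then have "moment_map (u i, u j, u k) \<in> interior (range moment_map)"
    by (rule moment_map_open_at)
  then obtain \<epsilon> where \<epsilon>: "\<epsilon> > 0" "ball (moment_map (u i, u j, u k)) \<epsilon> \<subseteq> range moment_map"
    by (auto simp: mem_interior)
  define R where "R = I - {i, j, k}"
  have split: "sum f I = f i + f j + f k + sum f R" for f :: "nat \<Rightarrow> real"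
  proof -
    have "I = insert i (insert j (insert k R))" using assms by (auto simp: R_def)
    moreover have "finite R" "i \<notin> R" "j \<notin> R" "k \<notin> R" using assms by (auto simp: R_def)
    ultimately show ?thesis using ne by simp
  qed
  show ?thesis
  proof (rule exI[of _ \<epsilon>], intro conjI allI impI)
    show "\<epsilon> > 0" by fact
  next
    fix v assume v: "\<bar>v - (\<Sum>i\<in>I. (u i)\<^sup>2 * exp (u i))\<bar> < \<epsilon>"
    obtain A B C where ABC: "moment_map (u i, u j, u k) = (A, B, C)" by (metis prod_cases3)
    define d where "d = v - (\<Sum>i\<in>I. (u i)\<^sup>2 * exp (u i))"
    have "(A, B, C + d) \<in> ball (A, B, C) \<epsilon>"
      using v by (simp add: dist_Pair_Pair dist_real_def d_def)
    then obtain x y z where xyz: "moment_map (x, y, z) = (A, B, C + d)"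
      using \<epsilon>(2) ABC by (metis (no_types, lifting) imageE prod_cases3 subsetD)
    define w where "w = u(i := x, j := y, k := z)"
    have w: "w i = x" "w j = y" "w k = z" using ne by (auto simp: w_def)
    have wR: "(\<Sum>l\<in>R. f (w l)) = (\<Sum>l\<in>R. f (u l))" for f :: "real \<Rightarrow> real"
      by (intro sum.cong) (auto simp: w_def R_def)
    show "\<exists>w. (\<Sum>i\<in>I. exp (w i)) = (\<Sum>i\<in>I. exp (u i)) \<and>
         (\<Sum>i\<in>I. w i * exp (w i)) = (\<Sum>i\<in>I. u i * exp (u i)) \<and>
         (\<Sum>i\<in>I. (w i)\<^sup>2 * exp (w i)) = v"
    proof (intro exI[of _ w] conjI)
      show "(\<Sum>i\<in>I. exp (w i)) = (\<Sum>i\<in>I. exp (u i))"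
        using xyz ABC wR[of exp] by (simp add: split w moment_map_def)
      show "(\<Sum>i\<in>I. w i * exp (w i)) = (\<Sum>i\<in>I. u i * exp (u i))"
        using xyz ABC wR[of "\<lambda>x. x * exp x"] by (simp add: split w moment_map_def)
      show "(\<Sum>i\<in>I. (w i)\<^sup>2 * exp (w i)) = v"
        using xyz ABC wR[of "\<lambda>x. x\<^sup>2 * exp x"] by (simp add: split w moment_map_def d_def)
    qed
  qed
qed

section \<open>Prescribing the pressure up to second order\<close>

theorem theorem1p8:
  fixes t_star a0 a1 :: real
  assumes "t_star > 0"
    and "a0 / t_star > a1"
  shows "\<exists>N::nat. \<forall>n\<ge>N. \<exists>m M::real. 0 \<le> m \<and> m < M \<and>
    (\<forall>a2\<in>{m..M}. \<exists>c :: nat \<Rightarrow> real.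
      let \<phi> = (\<lambda>x :: int \<Rightarrow> nat. c (x 0)) in
      \<exists>\<delta>>0. \<exists>C::real. \<forall>t\<in>{t_star - \<delta>..t_star + \<delta>}.
        \<bar>pressure n (\<lambda>x. t * \<phi> x)
          - (a0 + a1 * (t - t_star) + a2 / fact 2 * (t - t_star) ^ 2)\<bar>
        \<le> C * \<bar>t - t_star\<bar> ^ 3)"
proof -
  define h where "h = a0 - a1 * t_star"
  have "h > 0" using assms by (simp add: h_def field_simps)
  show ?thesis
  proof (intro exI[of _ "max 3 (nat \<lceil>exp h\<rceil> + 1)"] allI impI)
    fix n assume n: "max 3 (nat \<lceil>exp h\<rceil> + 1) \<le> n"
    then have "n \<ge> 3" by simp
    have "exp h < real n" using n by linarith
    then have "h < ln (real n)" using \<open>n \<ge> 3\<close> by (simp add: exp_less_cancel_iff[symmetric, of h] del: exp_less_cancel_iff)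
    then obtain u where u: "inj_on u {1..n}" "(\<Sum>i=1..n. exp (u i)) = 1"
        "(\<Sum>i=1..n. u i * exp (u i)) = - h"
      using geometric_distribution_of_entropy[of h n] \<open>h > 0\<close> \<open>n \<ge> 3\<close> by auto
    define Q where "Q = (\<Sum>i=1..n. (u i)\<^sup>2 * exp (u i))"
    obtain \<epsilon> where "\<epsilon> > 0" and \<epsilon>: "\<And>v. \<bar>v - Q\<bar> < \<epsilon> \<Longrightarrow> \<exists>w. (\<Sum>i=1..n. exp (w i)) = 1
        \<and> (\<Sum>i=1..n. w i * exp (w i)) = - h \<and> (\<Sum>i=1..n. (w i)\<^sup>2 * exp (w i)) = v"
      using second_moment_fills_interval[of "{1..n}" 1 2 3 u] u \<open>n \<ge> 3\<close> unfolding Q_def by auto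
    \<comment> \<open>As \<open>- h\<close> is the mean of \<open>u\<close>, the difference \<open>Q - h\<^sup>2\<close> is its variance.\<close>
    have "0 \<le> (\<Sum>i=1..n. (u i + h)\<^sup>2 * exp (u i))" by (intro sum_nonneg) simp
    also have "\<dots> = Q + 2 * h * (\<Sum>i=1..n. u i * exp (u i)) + h\<^sup>2 * (\<Sum>i=1..n. exp (u i))"
      unfolding Q_def sum_distrib_left sum.distrib[symmetric]
      by (intro sum.cong refl) (simp add: power2_eq_square algebra_simps)
    finally have var_nonneg: "Q - h\<^sup>2 \<ge> 0" using u by (simp add: power2_eq_square)
    define m where "m = (Q - h\<^sup>2) / t_star\<^sup>2"
    define M where "M = (Q - h\<^sup>2 + \<epsilon> / 2) / t_star\<^sup>2"
    have "0 \<le> m" "m < M"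
      using var_nonneg \<open>\<epsilon> > 0\<close> assms(1) by (simp_all add: m_def M_def divide_strict_right_mono)
    moreover have "\<exists>c :: nat \<Rightarrow> real.
      let \<phi> = (\<lambda>x :: int \<Rightarrow> nat. c (x 0)) in
      \<exists>\<delta>>0. \<exists>C::real. \<forall>t\<in>{t_star - \<delta>..t_star + \<delta>}.
        \<bar>pressure n (\<lambda>x. t * \<phi> x)
          - (a0 + a1 * (t - t_star) + a2 / fact 2 * (t - t_star) ^ 2)\<bar>
        \<le> C * \<bar>t - t_star\<bar> ^ 3" if a2: "a2 \<in> {m..M}" for a2
    proof -
      have "Q - h\<^sup>2 \<le> a2 * t_star\<^sup>2" "a2 * t_star\<^sup>2 \<le> Q - h\<^sup>2 + \<epsilon> / 2"
        using a2 assms(1) by (simp_all add: m_def M_def field_simps)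
      then have "\<bar>(a2 * t_star\<^sup>2 + h\<^sup>2) - Q\<bar> < \<epsilon>" using \<open>\<epsilon> > 0\<close> by linarith
      from \<epsilon>[OF this] obtain w where w: "(\<Sum>i=1..n. exp (w i)) = 1"
        "(\<Sum>i=1..n. w i * exp (w i)) = - h" "(\<Sum>i=1..n. (w i)\<^sup>2 * exp (w i)) = a2 * t_star\<^sup>2 + h\<^sup>2"
        by blast
      define c where "c i = (w i + a0) / t_star" for i
      have exp_c: "exp (t_star * c i) = exp (w i) * exp a0" for i
        using assms(1) by (simp add: c_def exp_add)
      have total: "(\<Sum>i=1..n. exp (t_star * c i)) = exp a0"
        unfolding exp_c sum_distrib_right[symmetric] w by simp
      have "(\<Sum>i=1..n. c i * exp (t_star * c i))
          = ((\<Sum>i=1..n. w i * exp (w i)) + a0 * (\<Sum>i=1..n. exp (w i))) / t_star * exp a0"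
        unfolding sum_distrib_left sum.distrib[symmetric] sum_divide_distrib sum_distrib_right exp_c
        by (intro sum.cong refl) (simp add: c_def algebra_simps)
      also have "\<dots> = a1 * exp a0"
        unfolding w using assms(1) by (simp add: h_def)
      finally have mean: "(\<Sum>i=1..n. c i * exp (t_star * c i)) = a1 * exp a0" .
      have "(\<Sum>i=1..n. (c i)\<^sup>2 * exp (t_star * c i))
          = ((\<Sum>i=1..n. (w i)\<^sup>2 * exp (w i)) + 2 * a0 * (\<Sum>i=1..n. w i * exp (w i))
             + a0\<^sup>2 * (\<Sum>i=1..n. exp (w i))) / t_star\<^sup>2 * exp a0"
        unfolding sum_distrib_left sum.distrib[symmetric] sum_divide_distrib sum_distrib_right exp_c
        by (intro sum.cong refl) (simp add: c_def power_divide power2_sum algebra_simps)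
      also have "\<dots> = (a2 * t_star\<^sup>2 + (a0 - h)\<^sup>2) / t_star\<^sup>2 * exp a0"
        unfolding w by (simp add: power2_eq_square algebra_simps)
      also have "\<dots> = (a2 + a1\<^sup>2) * exp a0"
        using assms(1) by (simp add: h_def power_mult_distrib field_simps)
      finally have square: "(\<Sum>i=1..n. (c i)\<^sup>2 * exp (t_star * c i)) = (a2 + a1\<^sup>2) * exp a0" .
      obtain C where C: "\<forall>t\<in>{t_star - 1..t_star + 1}.
          \<bar>ln (\<Sum>i=1..n. exp (t * c i)) - (a0 + a1 * (t - t_star) + a2 / 2 * (t - t_star)\<^sup>2)\<bar>
            \<le> C * \<bar>t - t_star\<bar> ^ 3"
        using log_sum_exp_taylor[OF _ _ total mean square] \<open>n \<ge> 3\<close> by auto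
      have "pressure n (\<lambda>x. t * c (x 0)) = ln (\<Sum>i=1..n. exp (t * c i))" for t
        using pressure_locally_constant[of n "\<lambda>j. t * c j"] \<open>n \<ge> 3\<close> by simp
      then show ?thesis
        unfolding Let_def using C by (intro exI[of _ c] exI[of _ "1::real"] exI[of _ C] conjI) simp_all
    qed
    ultimately show "\<exists>m M::real. 0 \<le> m \<and> m < M \<and>
    (\<forall>a2\<in>{m..M}. \<exists>c :: nat \<Rightarrow> real.
      let \<phi> = (\<lambda>x :: int \<Rightarrow> nat. c (x 0)) in
      \<exists>\<delta>>0. \<exists>C::real. \<forall>t\<in>{t_star - \<delta>..t_star + \<delta>}.
        \<bar>pressure n (\<lambda>x. t * \<phi> x)
          - (a0 + a1 * (t - t_star) + a2 / fact 2 * (t - t_star) ^ 2)\<bar>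
        \<le> C * \<bar>t - t_star\<bar> ^ 3)"
      by blast
  qed
qed

end
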